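(* Let $0<\gamma<\delta$ and $h\in H(\mathbb{D})$. The multiplication operator $M_h\colon A^{-\gamma}_0\to A^{-\delta}_0$ exists (i.e. $hf\in A^{-\delta}_0$ for all $f\in A^{-\gamma}_0$) if and only if $h\in A^{-(\delta-\gamma)}$. That is, $$\mathcal{M}(A^{-\gamma}_0,A^{-\delta}_0)=A^{-(\delta-\gamma)}.$$
   Context: $\mathbb{D}$ is the open unit disc in $\mathbb{C}$ and $H(\mathbb{D})$ is the space of analytic functions on $\mathbb{D}$. For $\gamma>0$, $A^{-\gamma}:=\{f\in H(\mathbb{D}): \|f\|_{-\gamma}:=\sup_{z\in\mathbb{D}}(1-|z|)^\gamma|f(z)|<\infty\}$ and $A^{-\gamma}_0:=\{f\in H(\mathbb{D}): \lim_{|z|\to1^-}(1-|z|)^\gamma|f(z)|=0\}$, both with norm $\|\cdot\|_{-\gamma}$. $M_hf:=hf$ denotes pointwise multiplication by $h$, and for Banach spaces $X,Y$ of analytic functions on $\mathbb{D}$, $\mathcal{M}(X,Y):=\{h\in H(\mathbb{D}): M_h(X)\subseteq Y\}$. *)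

theory Defs
  imports "HOL-Complex_Analysis.Complex_Analysis"
begin

text \<open>
  Analytic functions on the unit disc are total functions that are holomorphic on
  \<^term>\<open>ball 0 1 :: complex set\<close>. Values outside the disc are arbitrary and play no role in any
  of the definitions below, so all function spaces are closed under changing a function there.
\<close>

definition H_disc :: "(complex \<Rightarrow> complex) set" where
  "H_disc = {f. f holomorphic_on ball 0 1}"

text \<open>The weighted supremum takes values in the extended nonnegative reals, so that it is
  \<open>\<infinity>\<close> exactly when the weighted function is unbounded.\<close>

definition growth_norm :: "real \<Rightarrow> (complex \<Rightarrow> complex) \<Rightarrow> ennreal" where
  "growth_norm \<gamma> f = (SUP z\<in>ball 0 1. ennreal ((1 - norm z) powr \<gamma> * norm (f z)))"

definition A_space :: "real \<Rightarrow> (complex \<Rightarrow> complex) set" where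
  "A_space \<gamma> = {f \<in> H_disc. growth_norm \<gamma> f < \<infinity>}"

text \<open>The filter \<^term>\<open>filtercomap norm (at_left 1) :: complex filter\<close> expresses
  \<open>|z| \<rightarrow> 1\<close> from below, uniformly in the argument of \<open>z\<close>.\<close>

definition A0_space :: "real \<Rightarrow> (complex \<Rightarrow> complex) set" where
  "A0_space \<gamma> = {f \<in> H_disc.
     ((\<lambda>z. (1 - norm z) powr \<gamma> * norm (f z)) \<longlongrightarrow> 0) (filtercomap norm (at_left 1))}"

definition mult_op :: "(complex \<Rightarrow> complex) \<Rightarrow> (complex \<Rightarrow> complex) \<Rightarrow> (complex \<Rightarrow> complex)" where
  "mult_op h f = (\<lambda>z. h z * f z)"

definition multipliers ::
  "(complex \<Rightarrow> complex) set \<Rightarrow> (complex \<Rightarrow> complex) set \<Rightarrow> (complex \<Rightarrow> complex) set" where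
  "multipliers X Y = {h \<in> H_disc. mult_op h ` X \<subseteq> Y}"

end

theory Submission
  imports Defs
begin

text \<open>
  A function \<open>h\<close> outside \<open>A\<close> of order \<open>\<delta> - \<gamma>\<close> is refuted as a multiplier by a signed series
  \<open>f = (\<Sum>n. \<sigma> n * q ^ n * k n)\<close>, where \<open>k n z = (1 - cnj (a n) * z) powr (- \<gamma>)\<close>. Each \<open>k n\<close> is
  bounded, has weighted norm at most \<open>1\<close>, and attains it at \<open>a n\<close> up to the factor \<open>2 powr (- \<gamma>)\<close>.
  Choosing the signs one after the other, the partial sum up to \<open>n\<close> is at \<open>a n\<close> at least as large as
  its last term, whatever the points are, and for small \<open>q\<close> the tail cannot destroy this. Taking
  \<open>a n\<close> such that the weighted value of \<open>h\<close> there exceeds \<open>n / q ^ n\<close> makes \<open>h f\<close> unbounded for the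
  weight of order \<open>\<delta>\<close>.
\<close>

section \<open>The growth spaces and their boundary behaviour\<close>

lemma A_space_iff:
  "f \<in> A_space \<gamma> \<longleftrightarrow>
     f holomorphic_on ball 0 1 \<and> (\<exists>B. \<forall>z\<in>ball 0 1. (1 - norm z) powr \<gamma> * norm (f z) \<le> B)"
proof -
  have "growth_norm \<gamma> f < \<infinity> \<longleftrightarrow> (\<exists>B. \<forall>z\<in>ball 0 1. (1 - norm z) powr \<gamma> * norm (f z) \<le> B)"
  proof
    assume fin: "growth_norm \<gamma> f < \<infinity>"
    have "(1 - norm z) powr \<gamma> * norm (f z) \<le> enn2real (growth_norm \<gamma> f)" if "z \<in> ball 0 1" for z
    proof -
      have "ennreal ((1 - norm z) powr \<gamma> * norm (f z)) \<le> growth_norm \<gamma> f"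
        unfolding growth_norm_def using that by (rule SUP_upper)
      then show ?thesis
        using enn2real_mono[of _ "growth_norm \<gamma> f"] fin by fastforce
    qed
    then show "\<exists>B. \<forall>z\<in>ball 0 1. (1 - norm z) powr \<gamma> * norm (f z) \<le> B" by blast
  next
    assume "\<exists>B. \<forall>z\<in>ball 0 1. (1 - norm z) powr \<gamma> * norm (f z) \<le> B"
    then obtain B where "\<forall>z\<in>ball 0 1. (1 - norm z) powr \<gamma> * norm (f z) \<le> B" by blast
    then have "growth_norm \<gamma> f \<le> ennreal B"
      unfolding growth_norm_def by (intro SUP_least ennreal_leI) blast
    then show "growth_norm \<gamma> f < \<infinity>"
      using ennreal_less_top le_less_trans by (metis infinity_ennreal_def)
  qed
  then show ?thesis by (auto simp: A_space_def H_disc_def)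
qed

lemma eventually_disc_boundary:
  "eventually (\<lambda>z::complex. z \<in> ball 0 1) (filtercomap norm (at_left 1))"
  by (auto simp: eventually_filtercomap eventually_at_left_field
      intro!: exI[of _ "\<lambda>r. r < 1"] exI[of _ 0])

lemma weight_tendsto_0:
  assumes "0 < \<gamma>"
  shows "((\<lambda>z::complex. (1 - norm z) powr \<gamma>) \<longlongrightarrow> 0) (filtercomap norm (at_left 1))"
proof -
  have "((\<lambda>r::real. (1 - r) powr \<gamma>) \<longlongrightarrow> 0) (at_left 1)"
    using assms by (auto intro!: tendsto_eq_intros exI[of _ 0] simp: eventually_at_left_field)
  then show ?thesis
    by (rule filterlim_compose) (rule filterlim_filtercomap)
qed

lemma bounded_imp_A0_space:
  assumes "f holomorphic_on ball 0 1" "0 < \<gamma>" "\<And>z. z \<in> ball 0 1 \<Longrightarrow> norm (f z) \<le> B"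
  shows "f \<in> A0_space \<gamma>"
proof -
  have "((\<lambda>z::complex. (1 - norm z) powr \<gamma> * B) \<longlongrightarrow> 0) (filtercomap norm (at_left 1))"
    by (rule tendsto_mult_left_zero[OF weight_tendsto_0[OF assms(2)]])
  then have "((\<lambda>z. (1 - norm z) powr \<gamma> * norm (f z)) \<longlongrightarrow> 0) (filtercomap norm (at_left 1))"
    by (rule Lim_null_comparison[rotated])
      (use eventually_disc_boundary in eventually_elim, auto intro!: mult_left_mono assms(3))
  then show ?thesis using assms(1) by (simp add: A0_space_def H_disc_def)
qed

text \<open>Near the circle the weighted function is below \<open>1\<close>; on the remaining closed
  disc it is continuous, hence bounded by compactness.\<close>

lemma A0_space_subset_A_space: "A0_space \<gamma> \<subseteq> A_space \<gamma>"
proof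
  fix f assume f: "f \<in> A0_space \<gamma>"
  let ?g = "\<lambda>z. (1 - norm z) powr \<gamma> * norm (f z)"
  have hol: "f holomorphic_on ball 0 1" using f by (simp add: A0_space_def H_disc_def)
  have "(?g \<longlongrightarrow> 0) (filtercomap norm (at_left 1))" using f by (simp add: A0_space_def)
  then have "eventually (\<lambda>z. ?g z < 1) (filtercomap norm (at_left 1))"
    by (rule order_tendstoD) simp
  then obtain r where r: "r < 1" "\<And>z. r < norm z \<Longrightarrow> norm z < 1 \<Longrightarrow> ?g z < 1"
    unfolding eventually_filtercomap eventually_at_left_field by blast
  have "continuous_on (cball 0 r) ?g"
    using r(1) by (intro continuous_intros holomorphic_on_imp_continuous_on
        holomorphic_on_subset[OF hol]) auto
  then have "bounded (?g ` cball 0 r)"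
    by (intro compact_imp_bounded compact_continuous_image) auto
  then obtain B where B: "\<And>z. z \<in> cball 0 r \<Longrightarrow> norm (?g z) \<le> B"
    unfolding bounded_iff by blast
  have "?g z \<le> max 1 B" if "z \<in> ball 0 1" for z
    using r(2)[of z] B[of z] that by (cases "norm z \<le> r") auto
  then show "f \<in> A_space \<gamma>" using hol unfolding A_space_iff by blast
qed

text \<open>The majorant \<open>M\<close> makes the weighted series converge uniformly on the whole
  disc, so the boundary limit \<open>0\<close> passes from the partial sums to the sum. Without the
  weight the convergence is only locally uniform, which is enough for holomorphy.\<close>

lemma A0_space_suminf:
  assumes t: "\<And>i. t i \<in> A0_space \<gamma>"
    and le: "\<And>i z. z \<in> ball 0 1 \<Longrightarrow> (1 - norm z) powr \<gamma> * norm (t i z) \<le> M i"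
    and M: "summable M"
  shows "(\<lambda>z. \<Sum>i. t i z) \<in> A0_space \<gamma>"
proof -
  let ?F = "filtercomap norm (at_left 1) :: complex filter"
  have hol: "t i holomorphic_on ball 0 1" for i
    using t by (simp add: A0_space_def H_disc_def)
  have "(\<lambda>z. \<Sum>i. t i z) holomorphic_on ball 0 1"
  proof (rule holomorphic_uniform_sequence)
    show "(\<lambda>z. \<Sum>i<n. t i z) holomorphic_on ball 0 1" for n
      by (intro holomorphic_intros hol)
  next
    fix x :: complex assume x: "x \<in> ball 0 1"
    \<comment> \<open>Half the distance to the circle: the closed disc of radius \<open>d\<close>
      about \<open>x\<close> then keeps distance at least \<open>d\<close> from it.\<close>
    define d where "d = (1 - norm x) / 2"
    have d: "0 < d" using x by (simp add: d_def)
    have away: "norm z < 1" "d \<le> 1 - norm z" if "z \<in> cball x d" for z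
      using that norm_triangle_ineq2[of z x] x by (auto simp: d_def dist_norm norm_minus_commute)
    \<comment> \<open>The sign of \<gamma> is arbitrary here. The weight is smallest where
      \<open>1 - norm z\<close> is smallest if \<gamma> is nonnegative, and where it is largest
      otherwise; the bounds \<open>d\<close> and \<open>1\<close> cover the two cases.\<close>
    obtain K where K: "K > 0" "\<And>z. z \<in> cball x d \<Longrightarrow> K \<le> (1 - norm z) powr \<gamma>"
    proof
      show "min (d powr \<gamma>) (1 powr \<gamma>) > 0" using d by simp
      show "min (d powr \<gamma>) (1 powr \<gamma>) \<le> (1 - norm z) powr \<gamma>" if "z \<in> cball x d" for z
      proof (cases "\<gamma> \<ge> 0")
        case True
        then have "d powr \<gamma> \<le> (1 - norm z) powr \<gamma>"
          using away(2)[OF that] d by (intro powr_mono2) auto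
        then show ?thesis by simp
      next
        case False
        then have "1 powr \<gamma> \<le> (1 - norm z) powr \<gamma>"
          using away[OF that] d by (intro powr_mono2') auto
        then show ?thesis by simp
      qed
    qed
    have "uniform_limit (cball x d) (\<lambda>n z. \<Sum>i<n. t i z) (\<lambda>z. \<Sum>i. t i z) sequentially"
    proof (rule Weierstrass_m_test)
      fix i z assume z: "z \<in> cball x d"
      have "K * norm (t i z) \<le> (1 - norm z) powr \<gamma> * norm (t i z)"
        using K(2)[OF z] by (rule mult_right_mono) simp
      also have "\<dots> \<le> M i" using away[OF z] by (intro le) simp
      finally show "norm (t i z) \<le> M i / K" using K(1) by (simp add: field_simps)
    qed (use M in \<open>rule summable_divide\<close>)
    moreover have "cball x d \<subseteq> ball 0 1" using away by auto
    ultimately show "\<exists>d>0. cball x d \<subseteq> ball 0 1 \<and>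
        uniform_limit (cball x d) (\<lambda>n z. \<Sum>i<n. t i z) (\<lambda>z. \<Sum>i. t i z) sequentially"
      using d by blast
  qed simp
  moreover
  \<comment> \<open>The weight is absorbed into the complex terms, so that the M-test applies to
    them with majorant \<open>M\<close> and limits can be interchanged before norms are
    taken.\<close>
  let ?u = "\<lambda>i z. of_real ((1 - norm z) powr \<gamma>) * t i z"
  have norm_u: "norm (?u i z) = (1 - norm z) powr \<gamma> * norm (t i z)" for i z
    by (simp add: norm_mult)
  have "((\<lambda>z. \<Sum>i. ?u i z) \<longlongrightarrow> 0) ?F"
  proof (rule swap_uniform_limit')
    show "uniform_limit (ball 0 1) (\<lambda>n z. \<Sum>i<n. ?u i z) (\<lambda>z. \<Sum>i. ?u i z) sequentially"
      by (rule Weierstrass_m_test[OF _ M]) (simp only: norm_u le)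
    have "(?u i \<longlongrightarrow> 0) ?F" for i
      by (rule tendsto_norm_zero_cancel) (use t[of i] in \<open>simp only: norm_u A0_space_def mem_Collect_eq\<close>)
    then have "((\<lambda>z. \<Sum>i<n. ?u i z) \<longlongrightarrow> (\<Sum>i<n. 0)) ?F" for n
      by (intro tendsto_sum)
    then show "\<forall>\<^sub>F n in sequentially. ((\<lambda>z. \<Sum>i<n. ?u i z) \<longlongrightarrow> 0) ?F" by simp
  qed (use eventually_disc_boundary in auto)
  then have "((\<lambda>z. norm (\<Sum>i. ?u i z)) \<longlongrightarrow> 0) ?F" by (rule tendsto_norm_zero)
  moreover have "norm (\<Sum>i. ?u i z) = (1 - norm z) powr \<gamma> * norm (\<Sum>i. t i z)"
    if "z \<in> ball 0 1" for z
  proof -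
    have "summable (\<lambda>i. ?u i z)"
      by (rule summable_comparison_test'[OF M, of 0]) (use le[OF that] in \<open>simp only: norm_u\<close>)
    \<comment> \<open>Inside the disc the weight is nonzero and can be cancelled.\<close>
    then have "summable (\<lambda>i. t i z)" using that by (simp add: summable_cmult_iff)
    then show ?thesis by (simp add: suminf_mult norm_mult)
  qed
  ultimately show ?thesis
    unfolding A0_space_def H_disc_def
    by (auto elim!: Lim_transform_eventually intro: eventually_mono[OF eventually_disc_boundary])
qed

section \<open>Choice of signs\<close>

text \<open>If \<open>x\<close> is the sum of the earlier terms of row \<open>n\<close> and
  \<open>w\<close> its diagonal term, then \<open>2 w = (x + w) - (x - w)\<close>, so one of the two
  signs gives norm at least that of \<open>w\<close>. The choice at \<open>n\<close> depends only on
  earlier signs, hence a single sequence serves all rows.\<close>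

lemma exists_signs:
  fixes w :: "nat \<Rightarrow> nat \<Rightarrow> 'a::real_normed_vector"
  shows "\<exists>\<sigma>::nat \<Rightarrow> real. \<forall>n. \<bar>\<sigma> n\<bar> = 1 \<and> norm (w n n) \<le> norm (\<Sum>i\<le>n. \<sigma> i *\<^sub>R w n i)"
proof -
  define P where "P = (\<lambda>(\<sigma>::nat \<Rightarrow> real) n r.
    \<bar>r\<bar> = 1 \<and> norm (w n n) \<le> norm ((\<Sum>i<n. \<sigma> i *\<^sub>R w n i) + r *\<^sub>R w n n))"
  have "\<exists>\<sigma>. \<forall>n. P \<sigma> n (\<sigma> n)"
  proof (rule dependent_wellorder_choice)
    show "P \<sigma> n r = P \<tau> n r" if "\<And>i. i < n \<Longrightarrow> \<sigma> i = \<tau> i" for \<sigma> \<tau> n r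
      using that by (simp add: P_def)
    show "\<exists>r. P \<sigma> n r" for \<sigma> n
    proof -
      define x where "x = (\<Sum>i<n. \<sigma> i *\<^sub>R w n i)"
      have "2 * norm (w n n) = norm ((x + w n n) - (x - w n n))"
        by (simp flip: scaleR_2)
      also have "\<dots> \<le> norm (x + w n n) + norm (x - w n n)" by (rule norm_triangle_ineq4)
      finally have "norm (w n n) \<le> norm (x + w n n) \<or> norm (w n n) \<le> norm (x - w n n)"
        by linarith
      then have "P \<sigma> n 1 \<or> P \<sigma> n (-1)" by (simp add: P_def x_def)
      then show ?thesis by blast
    qed
  qed
  then show ?thesis by (simp add: P_def lessThan_Suc_atMost[symmetric])
qed

section \<open>Kernel functions peaking at a given point\<close>

definition disc_kernel :: "real \<Rightarrow> complex \<Rightarrow> complex \<Rightarrow> complex" where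
  "disc_kernel \<gamma> a z = (1 - cnj a * z) powr of_real (- \<gamma>)"

lemma norm_disc_kernel: "norm (disc_kernel \<gamma> a z) = norm (1 - cnj a * z) powr (- \<gamma>)"
  by (simp add: disc_kernel_def norm_powr_real_powr')

text \<open>The first bound is uniform in \<open>z\<close> and makes the kernel bounded; the second
  is uniform in \<open>a\<close> and bounds its weighted norm by \<open>1\<close>.\<close>

lemma norm_one_minus_ge:
  assumes "norm a < 1" "norm z < 1"
  shows "1 - norm a \<le> norm (1 - cnj a * z)" "1 - norm z \<le> norm (1 - cnj a * z)"
proof -
  have "1 - norm a * norm z \<le> norm (1 - cnj a * z)"
    using norm_triangle_ineq2[of 1 "cnj a * z"] by (simp add: norm_mult)
  moreover have "norm a * norm z \<le> norm a" "norm a * norm z \<le> norm z"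
    using assms by (auto simp: mult_left_le mult_left_le_one_le)
  ultimately show "1 - norm a \<le> norm (1 - cnj a * z)" "1 - norm z \<le> norm (1 - cnj a * z)"
    by linarith+
qed

lemma disc_kernel_in_A0_space:
  assumes "0 < \<gamma>" "norm a < 1"
  shows "disc_kernel \<gamma> a \<in> A0_space \<gamma>"
proof (rule bounded_imp_A0_space)
  \<comment> \<open>The base of the power lies in the open right half plane, away from the cut of
    the principal branch.\<close>
  have "1 - cnj a * z \<notin> \<real>\<^sub>\<le>\<^sub>0" if "z \<in> ball 0 1" for z
  proof -
    have "norm (cnj a * z) < 1"
      using assms(2) that mult_strict_mono'[of "norm a" 1 "norm z" 1] by (simp add: norm_mult)
    then have "Re (1 - cnj a * z) > 0"
      using complex_Re_le_cmod[of "cnj a * z"] by (simp del: times_complex.sel)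
    then show ?thesis by (auto simp: complex_nonpos_Reals_iff)
  qed
  then show "disc_kernel \<gamma> a holomorphic_on ball 0 1"
    unfolding disc_kernel_def by (intro holomorphic_intros) auto
  show "norm (disc_kernel \<gamma> a z) \<le> (1 - norm a) powr (- \<gamma>)" if "z \<in> ball 0 1" for z
    unfolding norm_disc_kernel using assms that
    by (intro powr_mono2' norm_one_minus_ge) auto
qed fact

lemma disc_kernel_le_1:
  assumes "0 < \<gamma>" "norm a < 1" "norm z < 1"
  shows "(1 - norm z) powr \<gamma> * norm (disc_kernel \<gamma> a z) \<le> 1"
proof -
  have "norm (disc_kernel \<gamma> a z) \<le> (1 - norm z) powr (- \<gamma>)"
    unfolding norm_disc_kernel using assms by (intro powr_mono2' norm_one_minus_ge) auto
  then have "(1 - norm z) powr \<gamma> * norm (disc_kernel \<gamma> a z)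
      \<le> (1 - norm z) powr \<gamma> * (1 - norm z) powr (- \<gamma>)"
    by (rule mult_left_mono) simp
  then show ?thesis using assms by (simp flip: powr_add)
qed

text \<open>On the diagonal the base is \<open>1 - (norm a)^2 = (1 + norm a) * (1 - norm a)\<close>:
  the second factor cancels against the weight and the first is at most \<open>2\<close>.\<close>

lemma disc_kernel_diag_ge:
  assumes "0 < \<gamma>" "norm a < 1"
  shows "2 powr (- \<gamma>) \<le> (1 - norm a) powr \<gamma> * norm (disc_kernel \<gamma> a a)"
proof -
  have "1 - cnj a * a = of_real (1 - (norm a)\<^sup>2)"
    using complex_norm_square[of a] by (simp add: mult.commute)
  then have "norm (1 - cnj a * a) = \<bar>1 - (norm a)\<^sup>2\<bar>"
    by (simp only: norm_of_real)
  also have "\<dots> = (1 + norm a) * (1 - norm a)"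
    using assms(2) abs_square_le_1[of "norm a"] by (simp add: power2_eq_square algebra_simps)
  finally have "norm (1 - cnj a * a) = (1 + norm a) * (1 - norm a)" .
  then have "norm (disc_kernel \<gamma> a a) = (1 + norm a) powr (- \<gamma>) * (1 - norm a) powr (- \<gamma>)"
    using assms(2) by (simp add: norm_disc_kernel powr_mult)
  then have "(1 - norm a) powr \<gamma> * norm (disc_kernel \<gamma> a a) = (1 + norm a) powr (- \<gamma>)"
    using assms(2) by (simp add: powr_minus field_simps)
  moreover have "2 powr (- \<gamma>) \<le> (1 + norm a) powr (- \<gamma>)"
    using assms by (intro powr_mono2') (auto simp: add_pos_nonneg)
  ultimately show ?thesis by simp
qed

section \<open>Test functions that are large along a sequence\<close>

text \<open>The constants \<open>q\<close> and \<open>c\<close> are fixed before the points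
  \<open>a n\<close>, because the points will later be chosen in terms of \<open>q\<close>.\<close>

lemma exists_A0_space_large_at:
  assumes \<gamma>: "0 < \<gamma>"
  obtains q c :: real where "0 < q" "0 < c"
    "\<And>a :: nat \<Rightarrow> complex. (\<And>n. norm (a n) < 1) \<Longrightarrow>
       \<exists>f\<in>A0_space \<gamma>. \<forall>n. c * q ^ n \<le> (1 - norm (a n)) powr \<gamma> * norm (f (a n))"
proof
  define c where "c = 2 powr (- \<gamma>)"
  \<comment> \<open>As \<open>c\<close> is at most \<open>1\<close>, \<open>q / (1 - q)\<close> is
    at most \<open>c / 3\<close>. The tail after \<open>n\<close> therefore costs at most half of
    the main term \<open>c * q ^ n\<close>, and \<open>c / 2\<close> remains.\<close>
  define q where "q = c / 4"
  have c: "0 < c" "c \<le> 1" using \<gamma> powr_mono[of "- \<gamma>" 0 2] by (auto simp: c_def)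
  then have q: "0 < q" "q \<le> 1 / 4" by (auto simp: q_def)
  show "0 < q" "0 < c / 2" using c q by auto
  fix a :: "nat \<Rightarrow> complex" assume a: "\<And>n. norm (a n) < 1"
  \<comment> \<open>Row \<open>n\<close> collects the values at \<open>a n\<close> of all scaled
    kernels.\<close>
  obtain \<sigma> :: "nat \<Rightarrow> real" where \<sigma>: "\<And>n. \<bar>\<sigma> n\<bar> = 1"
    and large: "\<And>n. norm (q ^ n *\<^sub>R disc_kernel \<gamma> (a n) (a n))
      \<le> norm (\<Sum>i\<le>n. \<sigma> i *\<^sub>R q ^ i *\<^sub>R disc_kernel \<gamma> (a i) (a n))"
    using exists_signs[of "\<lambda>n i. q ^ i *\<^sub>R disc_kernel \<gamma> (a i) (a n)"] by blast
  define t where "t i z = \<sigma> i *\<^sub>R q ^ i *\<^sub>R disc_kernel \<gamma> (a i) z" for i z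
  have t_le: "(1 - norm z) powr \<gamma> * norm (t i z) \<le> q ^ i" if "z \<in> ball 0 1" for i z
  proof -
    have "(1 - norm z) powr \<gamma> * norm (t i z)
        = q ^ i * ((1 - norm z) powr \<gamma> * norm (disc_kernel \<gamma> (a i) z))"
      using q by (simp add: t_def abs_mult \<sigma>)
    also have "\<dots> \<le> q ^ i * 1"
      using \<gamma> a that q by (intro mult_left_mono disc_kernel_le_1) auto
    finally show ?thesis by simp
  qed
  have q_sum: "summable (\<lambda>i. q ^ i)" using q by (intro summable_geometric) auto
  have "t i \<in> A0_space \<gamma>" for i
    using disc_kernel_in_A0_space[OF \<gamma> a[of i]] tendsto_mult_right_zero[of _ _ "q ^ i"] q
    by (auto simp: A0_space_def H_disc_def t_def[abs_def] \<sigma> scaleR_conv_of_real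
        mult.left_commute norm_mult norm_power intro!: holomorphic_intros)
  then have f: "(\<lambda>z. \<Sum>i. t i z) \<in> A0_space \<gamma>"
    using t_le q_sum by (rule A0_space_suminf)
  have "c / 2 * q ^ n \<le> (1 - norm (a n)) powr \<gamma> * norm (\<Sum>i. t i (a n))" for n
  proof -
    define W where "W = (1 - norm (a n)) powr \<gamma>"
    have W: "W > 0" using a[of n] by (simp add: W_def)
    have t_le': "norm (t i (a n)) \<le> q ^ i / W" for i
      using t_le[of "a n" i] a[of n] W by (simp add: W_def field_simps)
    have summ: "summable (\<lambda>i. norm (t i (a n)))"
      by (rule summable_comparison_test'[OF summable_divide[OF q_sum, of W], of 0]) (simp add: t_le')
    have tail: "norm (\<Sum>i. t (i + Suc n) (a n)) \<le> (q ^ n * (c / 2)) / W"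
    proof -
      have summ': "summable (\<lambda>i. norm (t (i + Suc n) (a n)))"
        using summ by (rule summable_ignore_initial_segment)
      have "(\<lambda>i. q ^ i * (q ^ Suc n / W)) sums (1 / (1 - q) * (q ^ Suc n / W))"
        using q by (intro sums_mult2 geometric_sums) auto
      then have S: "(\<lambda>i. q ^ (i + Suc n) / W) sums (1 / (1 - q) * (q ^ Suc n / W))"
        by (simp add: power_add mult_ac)
      have "norm (\<Sum>i. t (i + Suc n) (a n)) \<le> (\<Sum>i. norm (t (i + Suc n) (a n)))"
        using summ' by (rule summable_norm)
      also have "\<dots> \<le> 1 / (1 - q) * (q ^ Suc n / W)"
        using suminf_le[OF t_le' summ' sums_summable[OF S]] sums_unique[OF S] by simp
      also have "\<dots> = q ^ n * (q / (1 - q)) / W" by simp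
      also have "\<dots> \<le> (q ^ n * (c / 2)) / W"
      proof -
        have "q / (1 - q) \<le> c / 2" using c q(2) by (simp add: q_def field_simps)
        then show ?thesis using q W by (intro divide_right_mono mult_left_mono) auto
      qed
      finally show ?thesis .
    qed
    \<comment> \<open>The chain goes from the diagonal term to the signed partial sum that includes
      it, then to the full series minus the tail.\<close>
    have "c * q ^ n \<le> W * norm (q ^ n *\<^sub>R disc_kernel \<gamma> (a n) (a n))"
      using disc_kernel_diag_ge[OF \<gamma> a[of n]] q unfolding W_def c_def[symmetric]
      by (simp add: mult.left_commute[of _ "q ^ n"] mult.commute[of c])
    also have "\<dots> \<le> W * norm (\<Sum>i<Suc n. t i (a n))"
      using large[of n] W unfolding t_def lessThan_Suc_atMost by (intro mult_left_mono) auto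
    also have "(\<Sum>i<Suc n. t i (a n)) = (\<Sum>i. t i (a n)) - (\<Sum>i. t (i + Suc n) (a n))"
      using suminf_split_initial_segment[OF summable_norm_cancel[OF summ], of "Suc n"] by simp
    also have "W * norm \<dots> \<le> W * (norm (\<Sum>i. t i (a n)) + (q ^ n * (c / 2)) / W)"
      using tail W by (intro mult_left_mono norm_triangle_ineq4[THEN order_trans] add_mono) auto
    also have "\<dots> = W * norm (\<Sum>i. t i (a n)) + q ^ n * (c / 2)"
      using W by (simp add: field_simps)
    finally show ?thesis by (simp add: W_def field_simps)
  qed
  with f show "\<exists>f\<in>A0_space \<gamma>. \<forall>n. c / 2 * q ^ n \<le> (1 - norm (a n)) powr \<gamma> * norm (f (a n))"
    by (intro bexI[of _ "\<lambda>z. \<Sum>i. t i z"] allI)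
qed

section \<open>The two inclusions for the multiplier space\<close>

text \<open>Being an equality, this splitting of the weight serves both inclusions: it bounds the
  product from above and from below.\<close>

lemma weight_mult_op:
  "(1 - norm z) powr \<delta> * norm (mult_op h f z)
     = ((1 - norm z) powr (\<delta> - \<gamma>) * norm (h z)) * ((1 - norm z) powr \<gamma> * norm (f z))"
proof -
  have "(1 - norm z) powr \<delta> = (1 - norm z) powr (\<delta> - \<gamma>) * (1 - norm z) powr \<gamma>"
    by (simp flip: powr_add)
  then show ?thesis by (simp add: mult_op_def norm_mult)
qed

lemma mult_op_A0_space:
  assumes "h \<in> A_space (\<delta> - \<gamma>)" "f \<in> A0_space \<gamma>"
  shows "mult_op h f \<in> A0_space \<delta>"
proof -
  obtain B where B: "\<And>z. z \<in> ball 0 1 \<Longrightarrow> (1 - norm z) powr (\<delta> - \<gamma>) * norm (h z) \<le> B"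
    using assms(1) unfolding A_space_iff by blast
  have "((\<lambda>z. B * ((1 - norm z) powr \<gamma> * norm (f z))) \<longlongrightarrow> 0) (filtercomap norm (at_left 1))"
    using assms(2) by (intro tendsto_mult_right_zero) (simp add: A0_space_def)
  then have "((\<lambda>z. (1 - norm z) powr \<delta> * norm (mult_op h f z)) \<longlongrightarrow> 0)
      (filtercomap norm (at_left 1))"
  proof (rule Lim_null_comparison[rotated])
    show "\<forall>\<^sub>F z in filtercomap norm (at_left 1).
        norm ((1 - norm z) powr \<delta> * norm (mult_op h f z))
          \<le> B * ((1 - norm z) powr \<gamma> * norm (f z))"
      using eventually_disc_boundary
      unfolding weight_mult_op[where \<gamma> = \<gamma>]
      by eventually_elim (simp add: abs_mult mult_right_mono B)
  qed
  moreover have "mult_op h f holomorphic_on ball 0 1"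
    using assms unfolding mult_op_def A_space_def A0_space_def H_disc_def
    by (auto intro!: holomorphic_intros)
  ultimately show ?thesis by (simp add: A0_space_def H_disc_def)
qed

lemma multiplier_in_A_space:
  assumes \<gamma>: "0 < \<gamma>" and h: "h \<in> H_disc"
    and mult: "\<And>f. f \<in> A0_space \<gamma> \<Longrightarrow> mult_op h f \<in> A0_space \<delta>"
  shows "h \<in> A_space (\<delta> - \<gamma>)"
proof (rule ccontr)
  let ?H = "\<lambda>z. (1 - norm z) powr (\<delta> - \<gamma>) * norm (h z)"
  assume "h \<notin> A_space (\<delta> - \<gamma>)"
  then have unbdd: "\<exists>z. norm z < 1 \<and> B < ?H z" for B
    using h by (auto simp: A_space_iff H_disc_def not_le Ball_def)
  obtain q c :: real where q: "0 < q" and c: "0 < c"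
    and test: "\<And>a :: nat \<Rightarrow> complex. (\<And>n. norm (a n) < 1) \<Longrightarrow>
       \<exists>f\<in>A0_space \<gamma>. \<forall>n. c * q ^ n \<le> (1 - norm (a n)) powr \<gamma> * norm (f (a n))"
    using exists_A0_space_large_at[OF \<gamma>] by blast
  \<comment> \<open>The divisor \<open>q ^ n\<close> compensates the decay of the test function at
    \<open>a n\<close>, so that the product is at least \<open>n * c\<close> there.\<close>
  obtain a :: "nat \<Rightarrow> complex" where a: "\<And>n. norm (a n) < 1" "\<And>n. real n / q ^ n < ?H (a n)"
  proof -
    have "\<forall>n. \<exists>z. norm z < 1 \<and> real n / q ^ n < ?H z" using unbdd by blast
    then show thesis using that by metis
  qed
  obtain f where f: "f \<in> A0_space \<gamma>"
    and large: "\<And>n. c * q ^ n \<le> (1 - norm (a n)) powr \<gamma> * norm (f (a n))"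
    using test[of a] a(1) by blast
  \<comment> \<open>Boundedness of the weighted product already gives the contradiction.\<close>
  have "mult_op h f \<in> A_space \<delta>" using mult[OF f] A0_space_subset_A_space by blast
  then obtain B where B: "\<And>z. z \<in> ball 0 1 \<Longrightarrow> (1 - norm z) powr \<delta> * norm (mult_op h f z) \<le> B"
    unfolding A_space_iff by blast
  have "real n * c \<le> B" for n
  proof -
    have "real n * c = (real n / q ^ n) * (c * q ^ n)" using q by simp
    also have "\<dots> \<le> ?H (a n) * ((1 - norm (a n)) powr \<gamma> * norm (f (a n)))"
      using q c by (intro mult_mono large less_imp_le[OF a(2)]) auto
    also have "\<dots> \<le> B" using B[of "a n"] a(1) by (simp add: weight_mult_op[where \<gamma> = \<gamma>])
    finally show ?thesis .
  qed
  moreover obtain n where "B < real n * c" using reals_Archimedean3[OF c] by blast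
  ultimately show False by (simp add: not_le[symmetric])
qed

theorem proposition4p5:
  fixes \<gamma> \<delta> :: real
  assumes "0 < \<gamma>" and "\<gamma> < \<delta>"
  shows "(\<forall>h\<in>H_disc. (\<forall>f\<in>A0_space \<gamma>. mult_op h f \<in> A0_space \<delta>) \<longleftrightarrow> h \<in> A_space (\<delta> - \<gamma>))
       \<and> multipliers (A0_space \<gamma>) (A0_space \<delta>) = A_space (\<delta> - \<gamma>)"
proof -
  have *: "(\<forall>f\<in>A0_space \<gamma>. mult_op h f \<in> A0_space \<delta>) \<longleftrightarrow> h \<in> A_space (\<delta> - \<gamma>)"
    if "h \<in> H_disc" for h
    using multiplier_in_A_space[OF assms(1) that] mult_op_A0_space by blast
  moreover have "A_space (\<delta> - \<gamma>) \<subseteq> H_disc" by (auto simp: A_space_def)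
  ultimately show ?thesis unfolding multipliers_def by blast
qed

end
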